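(* Consider the network without a MAC-coordinator with $M\ge1$ stations, transmission probability $p\in(0,1)$, red arrival rate $\lambda_R$ and green arrival rate $\lambda_G$, as defined in the context. The system is stable if $\lambda_R<1-p$ and $$\begin{cases}\lambda_G<\Bigl(1-\frac{\lambda_R}{1-p}\Bigr)p, & \text{if } M=1,\\[4pt] \lambda_G<\frac{\lambda_R}{1-p}(M-1)p(1-p)^{M-1}+\Bigl(1-\frac{\lambda_R}{1-p}\Bigr)Mp(1-p)^{M-1}, & \text{if } M>1.\end{cases}$$
   Context: The network without a MAC-coordinator. There are $M$ stations numbered $1,\dots,M$, each with two infinite buffers, one for "red" and one for "green" messages. Time is slotted. $R^t_i$ and $G^t_i$ are the numbers of red and green messages in the buffers of station $i$ at the beginning of slot $t$. Let $i(t)=((t-1)\bmod M)+1$. Arrivals: the total numbers $\xi^t$ of new red messages in successive slots are i.i.d. non-negative integer-valued with finite mean $\lambda_R=\mathbf E\xi^t$; the total numbers $\eta^t$ of new green messages are i.i.d. non-negative integer-valued with finite mean $\lambda_G=\mathbf E\eta^t$, independent of the red arrivals. Each arriving message is independently assigned to one of the stations with equal probabilities $1/M$. Messages arriving in slot $t$ are counted in the queues from the beginning of slot $t+1$. Green attempts: in slot $t$, every station whose green buffer is non-empty attempts to transmit one green message with probability $p$, independently of everything else. Red attempts: in slot $t$, station $i(t)$ attempts to transmit one red message if its red buffer is non-empty; no other station attempts a red transmission. Outcomes: the red attempt of station $i(t)$ is successful (the red message leaves) if and only if station $i(t)$ does not attempt a green transmission in the same slot. A green attempt is successful (the green message leaves)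 if and only if it is the only green attempt in the slot and either it is made by a station other than $i(t)$, or it is made by station $i(t)$ and the red buffer of $i(t)$ is empty. All unsuccessful messages stay in their buffers. The system is called stable if its underlying Markov chain $(R^t_1,\dots,R^t_M,G^t_1,\dots,G^t_M)$ (whose transition law at time $t$ depends on $t$ only through $i(t)$) is positive recurrent: there is a finite set $D\subset\mathbb Z_+^{2M}$ such that, for every initial state and every initial value of $i(\cdot)$, the first return time to $D$ (at a time $\ge1$ step later) is a.s. finite, and the expected return time is bounded uniformly over initial states in $D$ and initial values of $i(\cdot)$. *)

theory Defs
  imports "HOL-Probability.Probability"
begin

text \<open>
  Buffer contents \<open>(R, G)\<close> of all stations: \<open>R j\<close> red and \<open>G j\<close> green messages at station \<open>j\<close>.
  Stations are the numbers \<open>1, \<dots>, M\<close>; functions are \<open>0\<close> elsewhere, so that \<open>state_space M\<close>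
  is a copy of the set of vectors of \<open>2 * M\<close> natural numbers.
\<close>

type_synonym state = "(nat \<Rightarrow> nat) \<times> (nat \<Rightarrow> nat)"

definition state_space :: "nat \<Rightarrow> state set" where
  "state_space M = PiE_dflt {1..M} 0 (\<lambda>_. UNIV) \<times> PiE_dflt {1..M} 0 (\<lambda>_. UNIV)"

text \<open>
  The randomness of one slot: the numbers of new red and of new green messages at each station,
  and the coins. A station transmits green iff its coin shows \<open>True\<close> and its green buffer is
  non-empty; coins of stations with an empty green buffer are ignored.
\<close>

type_synonym slot_input = "(nat \<Rightarrow> nat) \<times> (nat \<Rightarrow> nat) \<times> (nat \<Rightarrow> bool)"

definition arrivals :: "nat \<Rightarrow> nat pmf \<Rightarrow> (nat \<Rightarrow> nat) pmf" where
  "arrivals M N =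
     bind_pmf N (\<lambda>n.
       map_pmf (\<lambda>dest j. card {k. k < n \<and> dest k = j})
         (Pi_pmf {..<n} 0 (\<lambda>_. pmf_of_set {1..M})))"

definition coins :: "nat \<Rightarrow> real \<Rightarrow> (nat \<Rightarrow> bool) pmf" where
  "coins M p = Pi_pmf {1..M} False (\<lambda>_. bernoulli_pmf p)"

definition slot_law :: "nat \<Rightarrow> real \<Rightarrow> nat pmf \<Rightarrow> nat pmf \<Rightarrow> slot_input pmf" where
  "slot_law M p \<xi> \<eta> = pair_pmf (arrivals M \<xi>) (pair_pmf (arrivals M \<eta>) (coins M p))"

definition polled :: "nat \<Rightarrow> nat \<Rightarrow> nat" where
  "polled M t = (t - 1) mod M + 1"

definition green_attempts :: "(nat \<Rightarrow> nat) \<Rightarrow> (nat \<Rightarrow> bool) \<Rightarrow> nat set" where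
  "green_attempts G c = {j. G j > 0 \<and> c j}"

definition red_success :: "nat \<Rightarrow> (nat \<Rightarrow> bool) \<Rightarrow> state \<Rightarrow> nat \<Rightarrow> bool" where
  "red_success i c = (\<lambda>(R, G) j. j = i \<and> R i > 0 \<and> i \<notin> green_attempts G c)"

definition green_success :: "nat \<Rightarrow> (nat \<Rightarrow> bool) \<Rightarrow> state \<Rightarrow> nat \<Rightarrow> bool" where
  "green_success i c = (\<lambda>(R, G) j. green_attempts G c = {j} \<and> (j \<noteq> i \<or> R i = 0))"

definition next_state :: "nat \<Rightarrow> slot_input \<Rightarrow> state \<Rightarrow> state" where
  "next_state i = (\<lambda>(A, B, c) (R, G).
     (\<lambda>j. R j - of_bool (red_success i c (R, G) j) + A j,
      \<lambda>j. G j - of_bool (green_success i c (R, G) j) + B j))"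

text \<open>
  \<open>trajectory M t s \<omega> n\<close> is the state at the beginning of slot \<open>t + n\<close> when the state at the
  beginning of slot \<open>t\<close> is \<open>s\<close> and \<open>\<omega>\<close> lists the inputs of slots \<open>t, t + 1, \<dots>\<close>.
\<close>

primrec trajectory :: "nat \<Rightarrow> nat \<Rightarrow> state \<Rightarrow> slot_input stream \<Rightarrow> nat \<Rightarrow> state" where
  "trajectory M t s \<omega> 0 = s"
| "trajectory M t s \<omega> (Suc n) = next_state (polled M (t + n)) (\<omega> !! n) (trajectory M t s \<omega> n)"

definition return_time :: "'a set \<Rightarrow> (nat \<Rightarrow> 'a) \<Rightarrow> enat" where
  "return_time D X = (INF n \<in> {n. n \<ge> 1 \<and> X n \<in> D}. enat n)"

text \<open>Letting the initial slot \<open>t\<close> vary lets \<open>polled M t\<close> take every value in \<open>{1..M}\<close>.\<close>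

definition network_stable :: "nat \<Rightarrow> real \<Rightarrow> nat pmf \<Rightarrow> nat pmf \<Rightarrow> bool" where
  "network_stable M p \<xi> \<eta> \<longleftrightarrow>
     (\<exists>D \<subseteq> state_space M. finite D \<and>
        (\<forall>s \<in> state_space M. \<forall>t \<ge> 1.
           AE \<omega> in stream_space (slot_law M p \<xi> \<eta>).
             return_time D (trajectory M t s \<omega>) < \<infinity>) \<and>
        (\<exists>C :: real. \<forall>s \<in> D. \<forall>t \<ge> 1.
           (\<integral>\<^sup>+ \<omega>. ennreal_of_enat (return_time D (trajectory M t s \<omega>))
              \<partial>stream_space (slot_law M p \<xi> \<eta>)) \<le> ennreal C))"

end

theory Submission
  imports Defs
begin

text \<open>
  A Foster-Lyapunov argument with one-slot drift. Write \<open>q = 1 - p\<close>, \<open>r = p q ^ (M - 1)\<close>. While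
  \<open>G j > 0\<close>, the level \<open>G j + (r / q) R j\<close> is served at rate at least \<open>r\<close> in every slot: if \<open>j\<close> is
  polled with \<open>R j > 0\<close>, then a red message leaves with probability at least \<open>q\<close>, and otherwise a
  green one with probability at least \<open>r\<close>. The condition on \<open>lam_G\<close> says exactly that the mean input
  \<open>(lam_G + (r / q) lam_R) / M\<close> of this level is below \<open>r\<close>. The red queue, raised by \<open>q / M\<close> times
  the number of slots until the next poll of \<open>j\<close>, has drift \<open>(lam_R - q) / M\<close>.

  The two levels enter the Lyapunov function through a Huber function, quadratic up to \<open>N\<close> and
  linear beyond. Its slope grows to \<open>N\<close>, so one long queue outweighs the positive drift of
  the empty ones, whereas the second-order error is \<open>o(N)\<close> by dominated convergence although the
  arrivals have only a first moment.
\<close>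

section \<open>The Huber function\<close>

text \<open>Its derivative is \<open>min x N\<close>, the factor in front of the drift in all later
  estimates. Only the upper end is made linear, because the levels it is applied to are
  nonnegative.\<close>

definition huber :: "real \<Rightarrow> real \<Rightarrow> real" where
  "huber N x = (if x \<le> N then x\<^sup>2 / 2 else N * x - N\<^sup>2 / 2)"

lemma huber_nonneg: "N \<ge> 0 \<Longrightarrow> huber N x \<ge> 0"
proof -
  assume N: "N \<ge> 0"
  show ?thesis
  proof (cases "x \<le> N")
    case False
    then have "N * N \<le> N * x" using N by (intro mult_left_mono) auto
    moreover have "0 \<le> N * N" by simp
    ultimately have "N * N \<le> N * x * 2" by linarith
    then show ?thesis using False by (simp add: huber_def power2_eq_square)
  qed (simp add: huber_def)
qed

text \<open>The derivative \<open>min x N\<close> is 1-Lipschitz, so the first-order Taylor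
  remainder is at most half the squared increment.\<close>

lemma huber_increment_quadratic:
  assumes "N \<ge> 0" "x \<ge> 0" "y \<ge> 0"
  shows "huber N y \<le> huber N x + min x N * (y - x) + (y - x)\<^sup>2 / 2"
proof -
  have sq: "0 \<le> (y - N)\<^sup>2" "0 \<le> (x - N)\<^sup>2" "0 \<le> (x-y)\<^sup>2" by simp_all
  show ?thesis
  proof (cases "x \<le> N"; cases "y \<le> N")
    assume "\<not> x \<le> N" "y \<le> N"
    \<comment> \<open>This product is twice the slack of the claim in the present case.\<close>
    then have "0 \<le> (x - N) * (x + N - 2 * y)"
      by (intro mult_nonneg_nonneg) auto
    then show ?thesis using \<open>\<not> x \<le> N\<close> \<open>y \<le> N\<close>
      by (simp add: huber_def power2_eq_square field_simps)
  qed (use sq in \<open>simp_all add: huber_def power2_eq_square field_simps\<close>)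
qed

text \<open>On the nonnegative half-line the derivative lies between 0 and \<open>N\<close>. This
  remainder is linear in the increment, so a first moment is enough to integrate it.\<close>

lemma huber_increment_linear:
  assumes "N \<ge> 0" "x \<ge> 0" "y \<ge> 0"
  shows "huber N y \<le> huber N x + min x N * (y - x) + N * \<bar>y - x\<bar>"
proof (cases "x \<le> y")
  case True
  have "huber N y - huber N x \<le> N * (y - x)"
  proof (cases "y \<le> N")
    case yN: True
    have "(y - x) * (y + x) \<le> (y - x) * (2 * N)"
      using True yN assms by (intro mult_left_mono) auto
    then show ?thesis using True yN by (simp add: huber_def power2_eq_square algebra_simps)
  next
    case False
    have "0 \<le> (x - N)\<^sup>2" by simp
    then show ?thesis using False by (simp add: huber_def power2_eq_square algebra_simps)
  qed
  moreover have "0 \<le> min x N * (y - x)" using True assms by simp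
  ultimately show ?thesis using True by simp
next
  case False
  have "huber N y \<le> huber N x"
  proof (cases "x \<le> N")
    case True
    then show ?thesis using False assms
      by (simp add: huber_def)
  next
    case xN: False
    have "N * N \<le> N * x" "N * y \<le> N * x" using False xN assms by (auto intro!: mult_left_mono)
    moreover have "y * y \<le> N * N" if "y \<le> N" using that assms by (intro mult_mono) auto
    ultimately show ?thesis using xN by (auto simp: huber_def power2_eq_square)
  qed
  moreover have "0 \<le> (N - min x N) * (x - y)" using False by simp
  ultimately show ?thesis using False by (simp add: algebra_simps)
qed

text \<open>The better of the two remainder bounds is taken outcome by outcome. \<open>Y\<close>
  dominates the increment and controls the error. \<open>D\<close> bounds the increment from above
  and has an accessible mean; it may replace \<open>d\<close> since its factor
  \<open>min x N\<close> is nonnegative.\<close>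

lemma expectation_huber_le:
  fixes d Y :: "'a \<Rightarrow> real" and \<mu> :: "'a pmf"
  assumes N: "N \<ge> 0" and x: "x \<ge> 0"
    and Y: "integrable \<mu> Y"
    and xd: "\<And>\<omega>. x + d \<omega> \<ge> 0" and dY: "\<And>\<omega>. \<bar>d \<omega>\<bar> \<le> Y \<omega>"
    and dD: "\<And>\<omega>. d \<omega> \<le> D \<omega>" and D: "integrable \<mu> D"
  shows "integrable \<mu> (\<lambda>\<omega>. huber N (x + d \<omega>))"
    and "measure_pmf.expectation \<mu> (\<lambda>\<omega>. huber N (x + d \<omega>))
      \<le> huber N x + min x N * measure_pmf.expectation \<mu> D
        + measure_pmf.expectation \<mu> (\<lambda>\<omega>. min ((Y \<omega>)\<^sup>2 / 2) (N * Y \<omega>))"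
proof -
  have Y0: "0 \<le> Y \<omega>" for \<omega> using dY[of \<omega>] by linarith
  have d: "integrable \<mu> d"
    by (rule Bochner_Integration.integrable_bound[OF Y]) (use dY Y0 in auto)
  define h where "h \<omega> = min ((Y \<omega>)\<^sup>2 / 2) (N * Y \<omega>)" for \<omega>
  have h: "integrable \<mu> h"
    by (rule Bochner_Integration.integrable_bound[of _ "\<lambda>\<omega>. N * Y \<omega>"])
       (use Y Y0 N in \<open>auto simp: h_def\<close>)
  have le: "huber N (x + d \<omega>) \<le> huber N x + min x N * d \<omega> + h \<omega>" for \<omega>
  proof -
    have "(d \<omega>)\<^sup>2 \<le> (Y \<omega>)\<^sup>2" using dY[of \<omega>] Y0[of \<omega>] by (simp add: abs_le_square_iff [symmetric])
    moreover have "N * \<bar>d \<omega>\<bar> \<le> N * Y \<omega>" using dY N by (intro mult_left_mono)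
    ultimately show ?thesis
      using huber_increment_quadratic[OF N x xd[of \<omega>]] huber_increment_linear[OF N x xd[of \<omega>]]
      by (auto simp: h_def min_def)
  qed
  show int: "integrable \<mu> (\<lambda>\<omega>. huber N (x + d \<omega>))"
  proof (rule Bochner_Integration.integrable_bound)
    show "integrable \<mu> (\<lambda>\<omega>. huber N x + min x N * d \<omega> + h \<omega>)" using d h by simp
    show "AE \<omega> in \<mu>. norm (huber N (x + d \<omega>)) \<le> norm (huber N x + min x N * d \<omega> + h \<omega>)"
    proof (rule AE_I2)
      fix \<omega> show "norm (huber N (x + d \<omega>)) \<le> norm (huber N x + min x N * d \<omega> + h \<omega>)"
        using le[of \<omega>] huber_nonneg[OF N, of "x + d \<omega>"] by simp
    qed
  qed simp
  have "measure_pmf.expectation \<mu> (\<lambda>\<omega>. huber N (x + d \<omega>))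
      \<le> measure_pmf.expectation \<mu> (\<lambda>\<omega>. huber N x + min x N * d \<omega> + h \<omega>)"
    by (rule integral_mono) (use int d h le in auto)
  also have "\<dots> = huber N x + min x N * measure_pmf.expectation \<mu> d + measure_pmf.expectation \<mu> h"
    using d h by simp
  also have "min x N * measure_pmf.expectation \<mu> d \<le> min x N * measure_pmf.expectation \<mu> D"
    by (intro mult_left_mono integral_mono) (use d D dD x N in auto)
  finally show "measure_pmf.expectation \<mu> (\<lambda>\<omega>. huber N (x + d \<omega>))
      \<le> huber N x + min x N * measure_pmf.expectation \<mu> D
        + measure_pmf.expectation \<mu> (\<lambda>\<omega>. min ((Y \<omega>)\<^sup>2 / 2) (N * Y \<omega>))"
    by (simp add: h_def)
qed

text \<open>Dominated convergence: after division by \<open>n\<close> the integrand is at most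
  \<open>Y\<^sup>2 / (2 n)\<close>, which vanishes pointwise, and at most the integrable
  \<open>Y\<close>.\<close>

lemma tendsto_expectation_truncated_square:
  fixes Y :: "'a \<Rightarrow> real" and \<mu> :: "'a pmf"
  assumes Y: "integrable \<mu> Y" and Y0: "\<And>\<omega>. 0 \<le> Y \<omega>"
  shows "(\<lambda>n. measure_pmf.expectation \<mu> (\<lambda>\<omega>. min ((Y \<omega>)\<^sup>2 / 2) (real n * Y \<omega>)) / real n) \<longlonglongrightarrow> 0"
proof -
  define f where "f n \<omega> = min ((Y \<omega>)\<^sup>2 / 2) (real n * Y \<omega>) / real n" for n \<omega>
  have "(\<lambda>n. measure_pmf.expectation \<mu> (f n)) \<longlonglongrightarrow> measure_pmf.expectation \<mu> (\<lambda>_. 0)"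
  proof (rule integral_dominated_convergence[OF _ _ Y])
    show "AE \<omega> in \<mu>. (\<lambda>n. f n \<omega>) \<longlonglongrightarrow> 0"
    proof (rule AE_I2)
      fix \<omega>
      show "(\<lambda>n. f n \<omega>) \<longlonglongrightarrow> 0"
      proof (rule tendsto_sandwich)
        show "\<forall>\<^sub>F n in sequentially. 0 \<le> f n \<omega>"
          using Y0 by (auto simp: f_def)
        show "\<forall>\<^sub>F n in sequentially. f n \<omega> \<le> (Y \<omega>)\<^sup>2 / 2 / real n"
          unfolding f_def by (intro always_eventually allI divide_right_mono min.cobounded1) simp
        show "(\<lambda>n. (Y \<omega>)\<^sup>2 / 2 / real n) \<longlonglongrightarrow> 0"
          by (rule lim_const_over_n)
      qed simp
    qed
    show "AE \<omega> in \<mu>. norm (f n \<omega>) \<le> Y \<omega>" for n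
    proof (rule AE_I2)
      fix \<omega>
      show "norm (f n \<omega>) \<le> Y \<omega>"
        using Y0[of \<omega>] by (cases "n = 0") (auto simp: f_def field_simps)
    qed
  qed auto
  then show ?thesis by (simp add: f_def[abs_def])
qed

section \<open>The law of one slot\<close>

text \<open>Each of the \<open>n\<close> messages lands at \<open>j\<close> with probability
  \<open>1 / M\<close>. Computing with nonnegative integrals yields integrability and the value
  together.\<close>

lemma expectation_arrivals:
  assumes j: "j \<in> {1..M}" and N: "integrable (measure_pmf N) real"
  shows "integrable (arrivals M N) (\<lambda>a. real (a j))"
    and "measure_pmf.expectation (arrivals M N) (\<lambda>a. real (a j)) = measure_pmf.expectation N real / M"
proof -
  have M: "M > 0" using j by auto
  have coord: "(\<integral>\<^sup>+ f. of_bool (f k = j) \<partial>Pi_pmf {..<n} 0 (\<lambda>_. pmf_of_set {1..M})) = ennreal (1 / real M)"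
    if "k < n" for k n :: nat
  proof -
    have "(\<integral>\<^sup>+ f. of_bool (f k = j) \<partial>Pi_pmf {..<n} 0 (\<lambda>_. pmf_of_set {1..M}))
        = (\<integral>\<^sup>+ i. indicator {j} i \<partial>map_pmf (\<lambda>f. f k) (Pi_pmf {..<n} 0 (\<lambda>_. pmf_of_set {1..M})))"
      by (simp add: nn_integral_map_pmf indicator_def of_bool_def)
    also have "\<dots> = emeasure (pmf_of_set {1..M}) {j}"
      using that by (subst Pi_pmf_component) (simp_all del: nn_integral_map_pmf)
    also have "\<dots> = ennreal (1 / real M)"
      using j M by (simp add: emeasure_pmf_single)
    finally show ?thesis .
  qed
  have "(\<integral>\<^sup>+ f. of_nat (card {k. k < n \<and> f k = j}) \<partial>Pi_pmf {..<n} 0 (\<lambda>_. pmf_of_set {1..M}))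
        = ennreal (real n / real M)" for n
  proof -
    have card: "of_nat (card {k. k < n \<and> f k = j}) = (\<Sum>k<n. of_bool (f k = j) :: ennreal)" for f :: "nat \<Rightarrow> nat"
      by (simp add: of_bool_def sum.If_cases Int_def)
    have "(\<integral>\<^sup>+ f. of_nat (card {k. k < n \<and> f k = j}) \<partial>Pi_pmf {..<n} 0 (\<lambda>_. pmf_of_set {1..M}))
        = (\<Sum>k<n. \<integral>\<^sup>+ f. of_bool (f k = j) \<partial>Pi_pmf {..<n} 0 (\<lambda>_. pmf_of_set {1..M}))"
      unfolding card by (rule nn_integral_sum) simp
    also have "\<dots> = (\<Sum>k<n. ennreal (1 / real M))" by (intro sum.cong refl coord) auto
    also have "\<dots> = ennreal (real n / real M)"
      by (subst sum_ennreal) auto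
    finally show ?thesis .
  qed
  then have "(\<integral>\<^sup>+ a. ennreal (real (a j)) \<partial>arrivals M N) = (\<integral>\<^sup>+ n. ennreal (real n / M) \<partial>N)"
    by (simp add: arrivals_def nn_integral_map_pmf flip: ennreal_of_nat_eq_real_of_nat)
  also have "\<dots> = ennreal (measure_pmf.expectation N real / M)"
    using N by (subst nn_integral_eq_integral) auto
  finally have "integrable (arrivals M N) (\<lambda>a. real (a j)) \<and>
     measure_pmf.expectation (arrivals M N) (\<lambda>a. real (a j)) = measure_pmf.expectation N real / M"
    by (subst (asm) nn_integral_eq_integrable) (auto intro!: divide_nonneg_nonneg integral_nonneg)
  then show "integrable (arrivals M N) (\<lambda>a. real (a j))"
    and "measure_pmf.expectation (arrivals M N) (\<lambda>a. real (a j)) = measure_pmf.expectation N real / M"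
    by auto
qed

lemma arrivals_outside:
  assumes "a \<in> set_pmf (arrivals M N)" "j \<notin> {1..M}" "M \<ge> 1"
  shows "a j = 0"
proof -
  from assms(1) obtain n :: nat and f where f: "f \<in> set_pmf (Pi_pmf {..<n} 0 (\<lambda>_. pmf_of_set {1..M}))"
    and a: "a = (\<lambda>j. card {k. k < n \<and> f k = j})"
    unfolding arrivals_def by auto
  have "f k \<in> {1..M}" if "k < n" for k
    using f that assms(3) by (auto simp: set_Pi_pmf PiE_dflt_def)
  then have "{k. k < n \<and> f k = j} = {}" using assms(2) by auto
  then show ?thesis unfolding a by simp
qed

lemma prob_coin_tails:
  assumes "j \<in> {1..M}" "0 \<le> p" "p \<le> 1"
  shows "measure_pmf.expectation (coins M p) (\<lambda>c. of_bool (\<not> c j)) = 1 - p"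
proof -
  have "measure_pmf.expectation (coins M p) (\<lambda>c. of_bool (\<not> c j))
      = measure_pmf.expectation (map_pmf (\<lambda>c. c j) (coins M p)) (\<lambda>b. of_bool (\<not> b) :: real)"
    by simp
  also have "map_pmf (\<lambda>c. c j) (coins M p) = bernoulli_pmf p"
    using assms by (simp add: coins_def Pi_pmf_component)
  finally show ?thesis using assms by simp
qed

text \<open>The event is one coin vector, \<open>False\<close> outside \<open>{1..M}\<close> like
  the default in \<open>coins\<close>, so its probability is a product. With \<open>G j > 0\<close>
  it makes \<open>j\<close> the only green attempt whatever the other buffers hold.\<close>

lemma prob_single_heads:
  assumes "j \<in> {1..M}" "0 \<le> p" "p \<le> 1"
  shows "measure_pmf.expectation (coins M p) (\<lambda>c. of_bool (c = (\<lambda>k. k = j))) = p * (1 - p) ^ (M - 1)"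
proof -
  have "measure_pmf.expectation (coins M p) (\<lambda>c. of_bool (c = (\<lambda>k. k = j)))
     = pmf (coins M p) (\<lambda>k. k = j)"
  proof -
    have "(\<lambda>c. of_bool (c = (\<lambda>k. k = j)) :: real) = indicator {\<lambda>k. k = j}"
      by (auto simp: fun_eq_iff)
    then show ?thesis by (simp add: pmf.rep_eq)
  qed
  also have "\<dots> = (\<Prod>k\<in>{1..M}. if k = j then p else 1 - p)"
    unfolding coins_def using assms by (subst pmf_Pi) (auto intro!: prod.cong)
  also have "\<dots> = p * (\<Prod>k\<in>{1..M} - {j}. 1 - p)"
    using assms(1) by (subst prod.remove[of _ j]) auto
  also have "\<dots> = p * (1 - p) ^ (M - 1)" using assms(1) by (simp add: card_Diff_subset)
  finally show ?thesis .
qed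

section \<open>Foster's criterion for the network\<close>

text \<open>The set equality in \<open>green_success\<close> becomes a quantifier over stations, a
  form suited to coordinatewise measurability proofs.\<close>

lemma next_state_eq:
  "next_state i x s =
    (\<lambda>j. fst s j - of_bool (j = i \<and> fst s i > 0 \<and> \<not> (snd s i > 0 \<and> snd (snd x) i)) + fst x j,
     \<lambda>j. snd s j - of_bool ((\<forall>k. (snd s k > 0 \<and> snd (snd x) k) = (k = j)) \<and> (j \<noteq> i \<or> fst s i = 0))
         + fst (snd x) j)"
  by (auto simp: next_state_def red_success_def green_success_def green_attempts_def
      set_eq_iff fun_eq_iff split_beta)

lemma next_state_in_state_space:
  assumes "M \<ge> 1" "s \<in> state_space M" "x \<in> set_pmf (slot_law M p \<xi> \<eta>)"
  shows "next_state i x s \<in> state_space M"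
proof -
  have "fst s j = 0" "snd s j = 0" "fst x j = 0" "fst (snd x) j = 0" if "j \<notin> {1..M}" for j
    using assms that by (auto simp: slot_law_def state_space_def PiE_dflt_def dest: arrivals_outside)
  then show ?thesis
    unfolding next_state_eq state_space_def by (auto simp: PiE_dflt_def)
qed

text \<open>States are functions and form an uncountable type, so measurability is shown for each
  coordinate, a natural number. Red and green share one induction because each update reads both
  buffers.\<close>

lemma measurable_trajectory:
  fixes L :: "slot_input pmf"
  shows "(\<lambda>\<omega>. fst (trajectory M t s \<omega> n) j) \<in> measurable (stream_space L) (count_space UNIV)"
    and "(\<lambda>\<omega>. snd (trajectory M t s \<omega> n) j) \<in> measurable (stream_space L) (count_space UNIV)"
proof (induction n arbitrary: j)
  case (Suc n)
  have [measurable]: "(\<lambda>\<omega>. f (\<omega> !! n)) \<in> measurable (stream_space L) (count_space UNIV)"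
    for f :: "slot_input \<Rightarrow> 'c"
    by (rule measurable_compose[OF measurable_snth]) simp
  note Suc[measurable]
  { case 1 show ?case by (simp add: next_state_eq) }
  { case 2 show ?case by (simp add: next_state_eq) }
qed simp_all

text \<open>Equality with a point of \<open>D\<close> is a countable conjunction of coordinate
  equalities.\<close>

lemma measurable_trajectory_in_finite:
  fixes L :: "slot_input pmf"
  assumes "finite D"
  shows "Measurable.pred (stream_space L) (\<lambda>\<omega>. trajectory M t s \<omega> n \<in> D)"
proof -
  note measurable_trajectory[measurable]
  have *: "trajectory M t s \<omega> n \<in> D \<longleftrightarrow> (\<exists>d\<in>D. (\<forall>j. fst (trajectory M t s \<omega> n) j = fst d j) \<and>
      (\<forall>j. snd (trajectory M t s \<omega> n) j = snd d j))" for \<omega>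
    unfolding fun_eq_iff[symmetric] prod_eq_iff[symmetric] by blast
  show ?thesis unfolding * using assms by measurable
qed

section \<open>Return times and survival probabilities\<close>

lemma trajectory_Stream:
  "trajectory M t s (x ## \<omega>) (Suc n) = trajectory M (Suc t) (next_state (polled M t) x s) \<omega> n"
  by (induction n) simp_all

lemma less_return_time_iff: "enat n < return_time D X \<longleftrightarrow> (\<forall>m\<in>{1..n}. X m \<notin> D)"
proof -
  have "enat n < return_time D X \<longleftrightarrow> enat (Suc n) \<le> return_time D X"
    by (metis Suc_ile_eq)
  also have "\<dots> \<longleftrightarrow> (\<forall>m. m \<ge> 1 \<and> X m \<in> D \<longrightarrow> Suc n \<le> m)"
    by (auto simp: return_time_def le_INF_iff)
  also have "\<dots> \<longleftrightarrow> (\<forall>m\<in>{1..n}. X m \<notin> D)"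
    by (auto simp: not_less_eq_eq)
  finally show ?thesis .
qed

text \<open>The tail-sum formula, valid also at infinity. It turns an expected return time into a
  sum of survival probabilities.\<close>

lemma ennreal_of_enat_eq_suminf: "ennreal_of_enat e = (\<Sum>n. of_bool (enat n < e))"
proof (cases e)
  case (enat k)
  have "(\<Sum>n. of_bool (enat n < e)) = (\<Sum>n<k. of_bool (enat n < e) :: ennreal)"
    by (rule suminf_finite) (auto simp: enat)
  then show ?thesis by (simp add: enat)
next
  case infinity
  have "(\<Sum>n. 1 :: ennreal) = top"
    by (simp add: suminf_eq_SUP ennreal_SUP_of_nat_eq_top)
  then show ?thesis by (simp add: infinity)
qed

text \<open>Taken in \<open>ennreal\<close>, so that infinite sums and first-step recursions need no
  finiteness conditions.\<close>

definition survival :: "nat \<Rightarrow> slot_input pmf \<Rightarrow> state set \<Rightarrow> nat \<Rightarrow> nat \<Rightarrow> state \<Rightarrow> ennreal" where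
  "survival M L D n t s =
     (\<integral>\<^sup>+ \<omega>. of_bool (enat n < return_time D (trajectory M t s \<omega>)) \<partial>stream_space L)"

lemma measurable_survival:
  fixes L :: "slot_input pmf"
  assumes "finite D"
  shows "(\<lambda>\<omega>. of_bool (enat n < return_time D (trajectory M t s \<omega>)) :: ennreal)
    \<in> borel_measurable (stream_space L)"
proof -
  note measurable_trajectory_in_finite[OF assms, measurable]
  show ?thesis unfolding less_return_time_iff by measurable
qed

lemma survival_0: "survival M L D 0 t s = 1"
proof -
  interpret prob_space "stream_space L"
    by (rule prob_space.prob_space_stream_space) (rule measure_pmf.prob_space_axioms)
  show ?thesis by (simp add: survival_def less_return_time_iff emeasure_space_1)
qed

text \<open>First-step analysis: once the first input is fixed, the remaining inputs form a stream
  of the same law, and the trajectory restarts one slot later.\<close>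

lemma survival_Suc:
  assumes "finite D"
  shows "survival M L D (Suc n) t s =
    (\<integral>\<^sup>+ x. (if next_state (polled M t) x s \<in> D then 0
      else survival M L D n (Suc t) (next_state (polled M t) x s)) \<partial>L)"
proof -
  have "of_bool (enat (Suc n) < return_time D (trajectory M t s (x ## \<omega>))) =
     (if next_state (polled M t) x s \<in> D then 0
      else of_bool (enat n < return_time D (trajectory M (Suc t) (next_state (polled M t) x s) \<omega>)) :: ennreal)"
    for x \<omega>
  proof -
    have range: "(\<forall>m\<in>{1..Suc n}. P m) \<longleftrightarrow> P (Suc 0) \<and> (\<forall>m\<in>{1..n}. P (Suc m))" for P
    proof -
      have eq: "{1..Suc n} = insert (Suc 0) (Suc ` {1..n})" by auto
      show ?thesis unfolding eq by blast
    qed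
    show ?thesis
      unfolding less_return_time_iff range trajectory_Stream by simp
  qed
  then show ?thesis
    unfolding survival_def
    by (subst prob_space.nn_integral_stream_space[OF measure_pmf.prob_space_axioms measurable_survival[OF assms]])
       (auto intro!: nn_integral_cong)
qed

lemma nn_integral_return_time:
  assumes "finite D"
  shows "(\<integral>\<^sup>+ \<omega>. ennreal_of_enat (return_time D (trajectory M t s \<omega>))
      \<partial>stream_space (measure_pmf L))
    = (\<Sum>n. survival M L D n t s)"
  unfolding ennreal_of_enat_eq_suminf survival_def
  by (rule nn_integral_suminf) (rule measurable_survival[OF assms])

text \<open>Induction on the horizon by first-step analysis. The allowance \<open>b\<close> is paid
  only for the starting state, because counting stops at the first return to
  \<open>D\<close>.\<close>

lemma sum_survival_le:
  fixes V :: "nat \<Rightarrow> state \<Rightarrow> real"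
  assumes M: "M \<ge> 1" and D: "finite D"
    and V: "\<And>t s. V t s \<ge> 0"
    and int: "\<And>t s. s \<in> state_space M \<Longrightarrow> t \<ge> 1 \<Longrightarrow>
      integrable (slot_law M p \<xi> \<eta>) (\<lambda>x. V (Suc t) (next_state (polled M t) x s))"
    and drift: "\<And>t s. s \<in> state_space M \<Longrightarrow> t \<ge> 1 \<Longrightarrow>
      measure_pmf.expectation (slot_law M p \<xi> \<eta>) (\<lambda>x. V (Suc t) (next_state (polled M t) x s))
        \<le> V t s - 1 + b * of_bool (s \<in> D)"
    and s: "s \<in> state_space M" and t: "t \<ge> 1"
  shows "(\<Sum>n<N. survival M (slot_law M p \<xi> \<eta>) D n t s) \<le> ennreal (V t s + b * of_bool (s \<in> D))"
  using s t
proof (induction N arbitrary: t s)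
  case (Suc N)
  define L where "L = slot_law M p \<xi> \<eta>"
  let ?f = "\<lambda>x. next_state (polled M t) x s"
  have "(\<Sum>n<Suc N. survival M L D n t s) = 1 + (\<Sum>n<N. survival M L D (Suc n) t s)"
    by (simp add: sum.lessThan_Suc_shift survival_0 del: sum.lessThan_Suc)
  also have "(\<Sum>n<N. survival M L D (Suc n) t s)
     = (\<integral>\<^sup>+ x. (\<Sum>n<N. if ?f x \<in> D then 0 else survival M L D n (Suc t) (?f x)) \<partial>L)"
    by (simp add: survival_Suc[OF D] nn_integral_sum)
  also have "\<dots> \<le> (\<integral>\<^sup>+ x. ennreal (V (Suc t) (?f x)) \<partial>L)"
  proof (rule nn_integral_mono_AE, unfold AE_measure_pmf_iff, rule ballI)
    fix x assume "x \<in> set_pmf L"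
    then have "?f x \<in> state_space M"
      using next_state_in_state_space[OF M Suc.prems(1)] by (simp add: L_def)
    \<comment> \<open>The induction hypothesis is needed only outside \<open>D\<close>, where its
      \<open>b\<close> term vanishes; inside \<open>D\<close> the left side is 0.\<close>
    then show "(\<Sum>n<N. if ?f x \<in> D then 0 else survival M L D n (Suc t) (?f x))
      \<le> ennreal (V (Suc t) (?f x))"
      using Suc.IH[of "?f x" "Suc t"] by (cases "?f x \<in> D") (simp_all add: L_def)
  qed
  also have "\<dots> = ennreal (measure_pmf.expectation L (\<lambda>x. V (Suc t) (?f x)))"
    unfolding L_def by (rule nn_integral_eq_integral) (use int Suc.prems V in auto)
  also have "\<dots> \<le> ennreal (V t s - 1 + b * of_bool (s \<in> D))"
    unfolding L_def by (intro ennreal_leI drift Suc.prems)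
  also have "1 + ennreal (V t s - 1 + b * of_bool (s \<in> D)) = ennreal (V t s + b * of_bool (s \<in> D))"
  proof -
    \<comment> \<open>\<open>ennreal\<close> sends negative reals to 0, so the 1 can be moved inside
      only after the argument is known to be nonnegative.\<close>
    have "0 \<le> measure_pmf.expectation L (\<lambda>x. V (Suc t) (?f x))" using V by simp
    then have "0 \<le> V t s - 1 + b * of_bool (s \<in> D)"
      using drift[OF Suc.prems] unfolding L_def by linarith
    then show ?thesis by (simp flip: ennreal_1 ennreal_plus)
  qed
  finally show ?case by (simp add: L_def add_left_mono)
qed simp

text \<open>\<open>V\<close> may depend on the slot in order to follow the polling cycle. The bound
  from every start gives almost sure return, and \<open>c + b\<close> is the uniform bound on
  \<open>D\<close>.\<close>

lemma network_stable_Foster: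
  fixes V :: "nat \<Rightarrow> state \<Rightarrow> real"
  assumes M: "M \<ge> 1" and D: "finite D" "D \<subseteq> state_space M"
    and V: "\<And>t s. V t s \<ge> 0"
    and bounded: "\<And>t s. s \<in> D \<Longrightarrow> V t s \<le> c"
    and int: "\<And>t s. s \<in> state_space M \<Longrightarrow> t \<ge> 1 \<Longrightarrow>
      integrable (slot_law M p \<xi> \<eta>) (\<lambda>x. V (Suc t) (next_state (polled M t) x s))"
    and drift: "\<And>t s. s \<in> state_space M \<Longrightarrow> t \<ge> 1 \<Longrightarrow>
      measure_pmf.expectation (slot_law M p \<xi> \<eta>) (\<lambda>x. V (Suc t) (next_state (polled M t) x s))
        \<le> V t s - 1 + b * of_bool (s \<in> D)"
  shows "network_stable M p \<xi> \<eta>"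
proof -
  let ?S = "stream_space (slot_law M p \<xi> \<eta>)"
  have le: "(\<integral>\<^sup>+ \<omega>. ennreal_of_enat (return_time D (trajectory M t s \<omega>)) \<partial>?S)
      \<le> ennreal (V t s + b * of_bool (s \<in> D))" if "s \<in> state_space M" "t \<ge> 1" for s t
    unfolding nn_integral_return_time[OF D(1)] suminf_eq_SUP
    by (rule SUP_least) (rule sum_survival_le[OF M D(1) V int drift that])
  have "AE \<omega> in ?S. return_time D (trajectory M t s \<omega>) < \<infinity>" if st: "s \<in> state_space M" "t \<ge> 1" for s t
  proof -
    have "AE \<omega> in ?S. ennreal_of_enat (return_time D (trajectory M t s \<omega>)) \<noteq> \<infinity>"
    proof (rule nn_integral_PInf_AE)
      show "(\<lambda>\<omega>. ennreal_of_enat (return_time D (trajectory M t s \<omega>))) \<in> borel_measurable ?S"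
        unfolding ennreal_of_enat_eq_suminf
        by (intro borel_measurable_suminf_order measurable_survival[OF D(1)])
      show "(\<integral>\<^sup>+ \<omega>. ennreal_of_enat (return_time D (trajectory M t s \<omega>)) \<partial>?S) \<noteq> \<infinity>"
        using le[OF st] by (auto simp: top_unique)
    qed
    then show ?thesis
    proof eventually_elim
      case (elim \<omega>)
      then show ?case by (cases "return_time D (trajectory M t s \<omega>)") auto
    qed
  qed
  moreover have "(\<integral>\<^sup>+ \<omega>. ennreal_of_enat (return_time D (trajectory M t s \<omega>)) \<partial>?S)
      \<le> ennreal (c + b)" if "s \<in> D" "t \<ge> 1" for s t
  proof -
    have "ennreal (V t s + b * of_bool (s \<in> D)) \<le> ennreal (c + b)"
      using bounded[of s t] that by (intro ennreal_leI) simp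
    with le[of s t] that D(2) show ?thesis by (meson order_trans subsetD)
  qed
  ultimately show ?thesis
    unfolding network_stable_def using D by blast
qed

section \<open>Drift of the red and green levels\<close>

lemma expectation_slot_law:
  assumes j: "j \<in> {1..M}" and p: "0 \<le> p" "p \<le> 1"
    and \<xi>: "integrable (measure_pmf \<xi>) real" and \<eta>: "integrable (measure_pmf \<eta>) real"
  shows "integrable (slot_law M p \<xi> \<eta>) (\<lambda>x. real (fst x j))"
    and "measure_pmf.expectation (slot_law M p \<xi> \<eta>) (\<lambda>x. real (fst x j))
      = measure_pmf.expectation \<xi> real / M"
    and "integrable (slot_law M p \<xi> \<eta>) (\<lambda>x. real (fst (snd x) j))"
    and "measure_pmf.expectation (slot_law M p \<xi> \<eta>) (\<lambda>x. real (fst (snd x) j))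
      = measure_pmf.expectation \<eta> real / M"
    and "measure_pmf.expectation (slot_law M p \<xi> \<eta>) (\<lambda>x. of_bool (\<not> snd (snd x) j)) = 1 - p"
    and "measure_pmf.expectation (slot_law M p \<xi> \<eta>) (\<lambda>x. of_bool (snd (snd x) = (\<lambda>k. k = j)))
      = p * (1 - p) ^ (M - 1)"
proof -
  let ?L = "slot_law M p \<xi> \<eta>"
  have A: "map_pmf fst ?L = arrivals M \<xi>"
    and B: "map_pmf (\<lambda>x. fst (snd x)) ?L = arrivals M \<eta>"
    and C: "map_pmf (\<lambda>x. snd (snd x)) ?L = coins M p"
    by (simp_all add: slot_law_def map_fst_pair_pmf map_snd_pair_pmf
        flip: pmf.map_comp[unfolded comp_def])
  show "integrable ?L (\<lambda>x. real (fst x j))"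
    "measure_pmf.expectation ?L (\<lambda>x. real (fst x j)) = measure_pmf.expectation \<xi> real / M"
    using expectation_arrivals[OF j \<xi>] by (simp_all flip: A)
  show "integrable ?L (\<lambda>x. real (fst (snd x) j))"
    "measure_pmf.expectation ?L (\<lambda>x. real (fst (snd x) j)) = measure_pmf.expectation \<eta> real / M"
    using expectation_arrivals[OF j \<eta>] by (simp_all flip: B)
  show "measure_pmf.expectation ?L (\<lambda>x. of_bool (\<not> snd (snd x) j)) = 1 - p"
    using prob_coin_tails[OF j p] by (simp flip: C)
  show "measure_pmf.expectation ?L (\<lambda>x. of_bool (snd (snd x) = (\<lambda>k. k = j))) = p * (1 - p) ^ (M - 1)"
    using prob_single_heads[OF j p] by (simp flip: C)
qed

section \<open>The polling clock and a common bound on the increments\<close>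

lemma integrable_of_bool_pmf: "integrable (measure_pmf \<mu>) (\<lambda>x. of_bool (P x) :: real)"
  by (rule measure_pmf.integrable_const_bound[where B = 1]) auto

text \<open>Integer subtraction keeps the residue right when \<open>t > j\<close>. The value is 0 in
  the polling slot itself.\<close>

definition slots_to_poll :: "nat \<Rightarrow> nat \<Rightarrow> nat \<Rightarrow> nat" where
  "slots_to_poll M j t = nat ((int j - int t) mod int M)"

lemma slots_to_poll_less: "M \<ge> 1 \<Longrightarrow> slots_to_poll M j t < M"
  by (simp add: slots_to_poll_def nat_less_iff)

lemma polled_iff:
  assumes "j \<in> {1..M}" "t \<ge> 1"
  shows "polled M t = j \<longleftrightarrow> slots_to_poll M j t = 0"
proof -
  have "polled M t = j \<longleftrightarrow> (t - 1) mod M = (j - 1) mod M"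
    using assms by (auto simp: polled_def)
  also have "\<dots> \<longleftrightarrow> int (t - 1) mod int M = int (j - 1) mod int M"
    by (simp flip: zmod_int)
  also have "\<dots> \<longleftrightarrow> (int j - int t) mod int M = 0"
  proof -
    have "int (t - 1) - int (j - 1) = - (int j - int t)" using assms by (simp add: of_nat_diff)
    then show ?thesis unfolding mod_eq_dvd_iff dvd_eq_mod_eq_0[symmetric] by (simp only: dvd_minus_iff)
  qed
  also have "\<dots> \<longleftrightarrow> slots_to_poll M j t = 0"
  proof -
    have "(int j - int t) mod int M \<ge> 0" using assms by simp
    then show ?thesis unfolding slots_to_poll_def by linarith
  qed
  finally show ?thesis .
qed

text \<open>The clock ticks down by one per slot, and after a poll it jumps from 0 to
  \<open>M - 1\<close>.\<close>

lemma slots_to_poll_Suc: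
  assumes "j \<in> {1..M}" "t \<ge> 1"
  shows "real (slots_to_poll M j (Suc t)) = real (slots_to_poll M j t) - 1 + M * of_bool (polled M t = j)"
proof -
  define a where "a = (int j - int t) mod int M"
  have a: "0 \<le> a" "a < int M" using assms by (simp_all add: a_def)
  have "(int j - int (Suc t)) mod int M = (a - 1) mod int M"
    by (simp add: a_def mod_diff_left_eq algebra_simps)
  also have "\<dots> = (if a = 0 then int M - 1 else a - 1)"
    using a by (auto simp: zmod_minus1)
  finally show ?thesis
    using a unfolding polled_iff[OF assms] slots_to_poll_def a_def[symmetric] by auto
qed

text \<open>Dominates the one-slot increments of both levels at every station. It depends on the
  inputs only, so one second-order error serves all stations, slots and states.\<close>

definition input_bound :: "nat \<Rightarrow> real \<Rightarrow> slot_input \<Rightarrow> real" where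
  "input_bound M b x = (2 + b) * (1 + (\<Sum>j\<in>{1..M}. real (fst x j) + real (fst (snd x) j)))"

lemma input_bound_ge:
  assumes "j \<in> {1..M}" "b \<ge> 0"
  shows "(2 + b) * (1 + real (fst x j) + real (fst (snd x) j)) \<le> input_bound M b x"
proof -
  have "real (fst x j) + real (fst (snd x) j) \<le> (\<Sum>j\<in>{1..M}. real (fst x j) + real (fst (snd x) j))"
    using assms by (intro member_le_sum) auto
  then show ?thesis unfolding input_bound_def using assms by (intro mult_left_mono) auto
qed

lemma input_bound_nonneg: "b \<ge> 0 \<Longrightarrow> 0 \<le> input_bound M b x"
  by (simp add: input_bound_def sum_nonneg)

lemma integrable_input_bound:
  assumes p: "0 \<le> p" "p \<le> 1"
    and \<xi>: "integrable (measure_pmf \<xi>) real" and \<eta>: "integrable (measure_pmf \<eta>) real"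
  shows "integrable (slot_law M p \<xi> \<eta>) (input_bound M b)"
proof -
  have "integrable (slot_law M p \<xi> \<eta>)
      (\<lambda>x. (2 + b) * (1 + (\<Sum>j\<in>{1..M}. real (fst x j) + real (fst (snd x) j))))"
    by (intro integrable_mult_right Bochner_Integration.integrable_add Bochner_Integration.integrable_sum
        expectation_slot_law[OF _ p \<xi> \<eta>]) auto
  then show ?thesis by (simp add: input_bound_def[abs_def])
qed

text \<open>The clock term spreads the service of one poll over the cycle: the level loses
  \<open>q / M\<close> in each slot and gains \<open>q\<close> back at a poll, where a departure
  balances it.\<close>

definition red_level :: "nat \<Rightarrow> real \<Rightarrow> nat \<Rightarrow> state \<Rightarrow> nat \<Rightarrow> real" where
  "red_level M q t s j = real (fst s j) + q * real (slots_to_poll M j t) / M"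

definition green_level :: "real \<Rightarrow> state \<Rightarrow> nat \<Rightarrow> real" where
  "green_level b s j = real (snd s j) + b * real (fst s j)"

abbreviation truncated_square_mean :: "nat \<Rightarrow> real \<Rightarrow> nat pmf \<Rightarrow> nat pmf \<Rightarrow> real \<Rightarrow> real \<Rightarrow> real" where
  "truncated_square_mean M p \<xi> \<eta> b N \<equiv> measure_pmf.expectation (slot_law M p \<xi> \<eta>)
     (\<lambda>x. min ((input_bound M b x)\<^sup>2 / 2) (N * input_bound M b x))"

text \<open>At a poll with red messages present, a departure probability of at least
  \<open>1 - p\<close> pays for the clock jump of \<open>1 - p\<close>.\<close>

lemma red_drift:
  fixes \<xi> \<eta> p M t s
  defines "L \<equiv> slot_law M p \<xi> \<eta>" and "next \<equiv> \<lambda>x. next_state (polled M t) x s"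
  assumes j: "j \<in> {1..M}" and t: "t \<ge> 1" and p: "0 \<le> p" "p \<le> 1" and N: "N \<ge> 0" and b: "b \<ge> 0"
    and \<xi>: "integrable (measure_pmf \<xi>) real" and \<eta>: "integrable (measure_pmf \<eta>) real"
  shows "integrable L (\<lambda>x. huber N (red_level M (1 - p) (Suc t) (next x) j))"
    and "measure_pmf.expectation L (\<lambda>x. huber N (red_level M (1 - p) (Suc t) (next x) j))
      \<le> huber N (red_level M (1 - p) t s j)
        - (1 - p - measure_pmf.expectation \<xi> real) / M * min (red_level M (1 - p) t s j) N
        + truncated_square_mean M p \<xi> \<eta> b N"
proof -
  define i where "i = polled M t"
  define X where "X = red_level M (1 - p) t s j"
  define success where "success x \<longleftrightarrow> j = i \<and> fst s i > 0 \<and> \<not> (snd s i > 0 \<and> snd (snd x) i)"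
    for x :: slot_input
  define d where "d x = real (fst x j) - of_bool (success x) - (1 - p) / M + (1 - p) * of_bool (i = j)"
    for x :: slot_input
  \<comment> \<open>A departure is credited only when the coin shows tails. With an empty green
    buffer it is certain, so \<open>D\<close> is an upper bound whose mean ignores the green
    buffer.\<close>
  define D where "D x = real (fst x j) - of_bool (i = j \<and> fst s j > 0) * of_bool (\<not> snd (snd x) j)
     - (1 - p) / M + (1 - p) * of_bool (i = j)"
    for x :: slot_input
  have M: "M > 0" using j by auto
  have X0: "X \<ge> 0" using p by (simp add: X_def red_level_def)
  have eq: "red_level M (1 - p) (Suc t) (next x) j = X + d x" for x
  proof -
    have "success x \<Longrightarrow> fst s j > 0" by (auto simp: success_def)
    then have "real (fst (next x) j) = real (fst s j) - of_bool (success x) + real (fst x j)"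
      by (auto simp: next_def next_state_eq i_def success_def of_nat_diff)
    then show ?thesis
      using M by (simp add: red_level_def X_def d_def slots_to_poll_Suc[OF j t] i_def
          algebra_simps add_divide_distrib diff_divide_distrib)
  qed
  have xd: "X + d x \<ge> 0" for x
    using p unfolding eq[symmetric] by (simp add: red_level_def)
  have dY: "\<bar>d x\<bar> \<le> input_bound M b x" for x
  proof -
    have "0 \<le> (1 - p) / M" "(1 - p) / M \<le> 1" using p M by (auto simp: field_simps)
    moreover have "0 \<le> (of_bool (success x) :: real)" "of_bool (success x) \<le> (1 :: real)"
      "0 \<le> (1 - p) * of_bool (i = j)" "(1 - p) * of_bool (i = j) \<le> 1"
      using p by (auto simp: of_bool_def)
    ultimately have "\<bar>d x\<bar> \<le> 2 + real (fst x j)"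
      unfolding d_def using of_nat_0_le_iff[of "fst x j", where ?'a = real] by linarith
    also have "\<dots> \<le> (2 + b) * (1 + real (fst x j) + real (fst (snd x) j))"
      using b by (simp add: algebra_simps)
    also have "\<dots> \<le> input_bound M b x" by (rule input_bound_ge[OF j b])
    finally show ?thesis .
  qed
  have dD: "d x \<le> D x" for x
    by (auto simp: d_def D_def success_def)
  note law = expectation_slot_law[OF j p \<xi> \<eta>, folded L_def]
  have D: "integrable L D"
    unfolding D_def by (intro Bochner_Integration.integrable_add Bochner_Integration.integrable_diff
      law integrable_mult_right integrable_of_bool_pmf) auto
  note huber = expectation_huber_le[OF N X0 _ xd dY dD D]
  have Y: "integrable L (input_bound M b)"
    unfolding L_def by (rule integrable_input_bound[OF p \<xi> \<eta>])
  show "integrable L (\<lambda>x. huber N (red_level M (1 - p) (Suc t) (next x) j))"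
    unfolding eq by (rule huber(1)[OF Y])
  have "measure_pmf.expectation L D = measure_pmf.expectation \<xi> real / M
     - of_bool (i = j \<and> fst s j > 0) * (1 - p) - (1 - p) / M + (1 - p) * of_bool (i = j)"
    unfolding D_def by (simp add: law integrable_of_bool_pmf)
  \<comment> \<open>At a poll of an empty red queue nothing pays for the clock jump, but queue and
    clock are both 0, so the first-order term vanishes.\<close>
  moreover have "X = 0" if "i = j" "fst s j = 0"
    using that polled_iff[OF j t] by (simp add: X_def red_level_def i_def)
  ultimately have "min X N * measure_pmf.expectation L D
      = min X N * (measure_pmf.expectation \<xi> real / M - (1 - p) / M)"
    using N by (cases "i = j"; cases "fst s j = 0") auto
  then show "measure_pmf.expectation L (\<lambda>x. huber N (red_level M (1 - p) (Suc t) (next x) j))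
      \<le> huber N (red_level M (1 - p) t s j)
        - (1 - p - measure_pmf.expectation \<xi> real) / M * min (red_level M (1 - p) t s j) N
        + truncated_square_mean M p \<xi> \<eta> b N"
    using huber(2)[OF Y] unfolding eq X_def[symmetric] L_def
    by (simp add: algebra_simps diff_divide_distrib add_divide_distrib)
qed

text \<open>The weight \<open>b\<close> makes a red departure with probability \<open>1 - p\<close>
  worth \<open>r\<close>, as much as a green one with probability \<open>r\<close>. No service is
  credited while the green buffer is empty.\<close>

lemma green_drift:
  fixes \<xi> \<eta> p M t s
  defines "L \<equiv> slot_law M p \<xi> \<eta>" and "next \<equiv> \<lambda>x. next_state (polled M t) x s"
    and "r \<equiv> p * (1 - p) ^ (M - 1)"
  assumes j: "j \<in> {1..M}" and p: "0 \<le> p" "p \<le> 1" and N: "N \<ge> 0"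
    and b: "b \<ge> 0" "b * (1 - p) = r"
    and \<xi>: "integrable (measure_pmf \<xi>) real" and \<eta>: "integrable (measure_pmf \<eta>) real"
  shows "integrable L (\<lambda>x. huber N (green_level b (next x) j))"
    and "measure_pmf.expectation L (\<lambda>x. huber N (green_level b (next x) j))
      \<le> huber N (green_level b s j)
        + ((measure_pmf.expectation \<eta> real + b * measure_pmf.expectation \<xi> real) / M
            - r * of_bool (snd s j > 0)) * min (green_level b s j) N
        + truncated_square_mean M p \<xi> \<eta> b N"
proof -
  define i where "i = polled M t"
  define W where "W = green_level b s j"
  define rs where "rs x \<longleftrightarrow> j = i \<and> fst s i > 0 \<and> \<not> (snd s i > 0 \<and> snd (snd x) i)"
    for x :: slot_input
  define gs where "gs x \<longleftrightarrow> (\<forall>k. (snd s k > 0 \<and> snd (snd x) k) = (k = j)) \<and> (j \<noteq> i \<or> fst s i = 0)"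
    for x :: slot_input
  define d where "d x = real (fst (snd x) j) + b * real (fst x j) - of_bool (gs x) - b * of_bool (rs x)"
    for x :: slot_input
  \<comment> \<open>The two exclusive ways to serve the level while \<open>G j > 0\<close>; in the
    \<open>red\<close> case \<open>j\<close> is polled with red messages and its own green attempt
    cannot succeed.\<close>
  define green red :: real where "green = of_bool (snd s j > 0 \<and> (j \<noteq> i \<or> fst s i = 0))"
    and "red = of_bool (snd s j > 0 \<and> \<not> (j \<noteq> i \<or> fst s i = 0))"
  define D where "D x = real (fst (snd x) j) + b * real (fst x j)
     - green * of_bool (snd (snd x) = (\<lambda>k. k = j)) - red * (b * of_bool (\<not> snd (snd x) j))"
    for x :: slot_input
  have W0: "W \<ge> 0" using b by (simp add: W_def green_level_def)
  have eq: "green_level b (next x) j = W + d x" for x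
  proof -
    have "rs x \<Longrightarrow> fst s j > 0" by (auto simp: rs_def)
    then have 1: "real (fst (next x) j) = real (fst s j) - of_bool (rs x) + real (fst x j)"
      by (auto simp: next_def next_state_eq i_def rs_def of_nat_diff)
    have "gs x \<Longrightarrow> snd s j > 0" by (auto simp: gs_def)
    then have 2: "real (snd (next x) j) = real (snd s j) - of_bool (gs x) + real (fst (snd x) j)"
      unfolding next_def next_state_eq snd_conv gs_def[symmetric] i_def[symmetric]
      by (auto simp: of_nat_diff)
    show ?thesis
      unfolding green_level_def W_def d_def 1 2 by (simp add: algebra_simps)
  qed
  have xd: "W + d x \<ge> 0" for x
    using b unfolding eq[symmetric] by (simp add: green_level_def)
  have dY: "\<bar>d x\<bar> \<le> input_bound M b x" for x
  proof -
    have "0 \<le> b * real (fst x j)" "0 \<le> b * of_bool (rs x)" "b * of_bool (rs x) \<le> b"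
      "0 \<le> (of_bool (gs x) :: real)" "of_bool (gs x) \<le> (1 :: real)"
      using b(1) by (auto simp: of_bool_def)
    then have "\<bar>d x\<bar> \<le> 1 + b + real (fst (snd x) j) + b * real (fst x j)"
      using b(1) of_nat_0_le_iff[of "fst (snd x) j", where ?'a = real] unfolding d_def by linarith
    also have "\<dots> \<le> (2 + b) * (1 + real (fst x j) + real (fst (snd x) j))"
      using b(1) by (simp add: algebra_simps)
    also have "\<dots> \<le> input_bound M b x" by (rule input_bound_ge[OF j b(1)])
    finally show ?thesis .
  qed
  have dD: "d x \<le> D x" for x
    using b(1) by (auto simp: d_def D_def rs_def gs_def green_def red_def)
  note law = expectation_slot_law[OF j p \<xi> \<eta>, folded L_def]
  have D: "integrable L D"
    unfolding D_def by (intro Bochner_Integration.integrable_add Bochner_Integration.integrable_diff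
      law integrable_mult_right integrable_of_bool_pmf)
  note huber = expectation_huber_le[OF N W0 _ xd dY dD D]
  have Y: "integrable L (input_bound M b)"
    unfolding L_def by (rule integrable_input_bound[OF p \<xi> \<eta>])
  show "integrable L (\<lambda>x. huber N (green_level b (next x) j))"
    unfolding eq by (rule huber(1)[OF Y])
  have "measure_pmf.expectation L D = measure_pmf.expectation \<eta> real / M
     + b * (measure_pmf.expectation \<xi> real / M) - green * r - red * (b * (1 - p))"
    unfolding D_def by (simp add: law integrable_of_bool_pmf r_def)
  also have "\<dots> = (measure_pmf.expectation \<eta> real + b * measure_pmf.expectation \<xi> real) / M
            - r * of_bool (snd s j > 0)"
    unfolding b(2) by (auto simp: green_def red_def add_divide_distrib)
  finally show "measure_pmf.expectation L (\<lambda>x. huber N (green_level b (next x) j))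
      \<le> huber N (green_level b s j)
        + ((measure_pmf.expectation \<eta> real + b * measure_pmf.expectation \<xi> real) / M
            - r * of_bool (snd s j > 0)) * min (green_level b s j) N
        + truncated_square_mean M p \<xi> \<eta> b N"
    using huber(2)[OF Y] unfolding eq W_def[symmetric] L_def
    by (simp add: mult.commute)
qed

section \<open>Stability\<close>

lemma huber_le_square: "huber N x \<le> x\<^sup>2 / 2"
  using zero_le_power2[of "x - N"] by (simp add: huber_def power2_eq_square field_simps)

lemma finite_bounded_states:
  "finite {s \<in> state_space M. \<forall>j\<in>{1..M}. fst s j \<le> n \<and> snd s j \<le> n}"
proof (rule finite_subset)
  show "{s \<in> state_space M. \<forall>j\<in>{1..M}. fst s j \<le> n \<and> snd s j \<le> n}
     \<subseteq> PiE_dflt {1..M} 0 (\<lambda>_. {..n}) \<times> PiE_dflt {1..M} 0 (\<lambda>_. {..n})"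
    by (auto simp: state_space_def PiE_dflt_def)
qed (auto intro!: finite_cartesian_product finite_PiE_dflt)

lemma network_stable_if_rates:
  fixes M :: nat and p :: real and \<xi> \<eta> :: "nat pmf"
  defines "lam_R \<equiv> measure_pmf.expectation \<xi> real" and "lam_G \<equiv> measure_pmf.expectation \<eta> real"
  assumes M: "M \<ge> 1" and p: "0 < p" "p < 1"
    and \<xi>: "integrable (measure_pmf \<xi>) real" and \<eta>: "integrable (measure_pmf \<eta>) real"
    and red: "lam_R < 1 - p"
    and green: "lam_G < (real M - lam_R / (1 - p)) * (p * (1 - p) ^ (M - 1))"
  shows "network_stable M p \<xi> \<eta>"
proof -
  define r where "r = p * (1 - p) ^ (M - 1)"
  define b where "b = r / (1 - p)"
  \<comment> \<open>The mean input of one green level per slot; the hypothesis \<open>green\<close>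
    says \<open>c < r\<close>.\<close>
  define c where "c = (lam_G + b * lam_R) / M"
  define \<epsilon>R where "\<epsilon>R = (1 - p - lam_R) / M"
  define \<epsilon> where "\<epsilon> = min \<epsilon>R (r - c)"
  \<comment> \<open>While \<open>G j = 0\<close> the green level can rise at rate \<open>c\<close>,
    but it is then a multiple of the red queue. The excess \<open>K - 1\<close> of the red weight
    absorbs this rise.\<close>
  define K where "K = 1 + c * (1 + b) / \<epsilon>R"
  have p': "0 \<le> p" "p \<le> 1" using p by auto
  have b: "b \<ge> 0" "b * (1 - p) = r" using p by (simp_all add: b_def r_def)
  have lam: "lam_R \<ge> 0" "lam_G \<ge> 0" by (simp_all add: lam_R_def lam_G_def)
  have c: "c \<ge> 0" using lam b by (simp add: c_def)
  have \<epsilon>R: "\<epsilon>R > 0" using red M by (simp add: \<epsilon>R_def)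
  have "lam_G + b * lam_R < r * M" using green by (simp add: b_def r_def algebra_simps)
  then have \<epsilon>G: "r - c > 0" using M by (simp add: c_def field_simps)
  have \<epsilon>: "\<epsilon> > 0" using \<epsilon>R \<epsilon>G by (simp add: \<epsilon>_def)
  have K: "K \<ge> 1" using c b \<epsilon>R by (simp add: K_def)
  let ?e = "truncated_square_mean M p \<xi> \<eta> b"

  have "(\<lambda>n. M * (K + 1) * (?e (real n) / real n)) \<longlonglongrightarrow> M * (K + 1) * 0"
    by (intro tendsto_mult tendsto_const tendsto_expectation_truncated_square
        integrable_input_bound[OF p' \<xi> \<eta>] input_bound_nonneg b)
  then have "\<forall>\<^sub>F n in sequentially. M * (K + 1) * (?e (real n) / real n) < \<epsilon> / 2"
    using \<epsilon> by (intro order_tendstoD) auto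
  moreover have "\<forall>\<^sub>F n in sequentially. real n \<ge> max 1 (2 / \<epsilon>)"
    using filterlim_real_sequentially unfolding filterlim_at_top by blast
  ultimately have "\<forall>\<^sub>F n in sequentially. M * (K + 1) * (?e (real n) / real n) < \<epsilon> / 2 \<and> real n \<ge> max 1 (2 / \<epsilon>)"
    by (rule eventually_conj)
  \<comment> \<open>\<open>n\<close> serves as truncation level and as queue bound of the finite
    set. The total error is below half of \<open>\<epsilon> * n\<close>, and
    \<open>n \<ge> 2 / \<epsilon>\<close> leaves a drift of at least one unit.\<close>
  then obtain n :: nat where n: "M * (K + 1) * (?e n / n) < \<epsilon> / 2" "real n \<ge> max 1 (2 / \<epsilon>)"
    unfolding eventually_sequentially by blast
  define err where "err = M * (K + 1) * ?e n"
  have "err < \<epsilon> / 2 * n" "1 \<le> \<epsilon> / 2 * n"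
    using n \<epsilon> by (auto simp: err_def field_simps)
  then have err: "err \<le> \<epsilon> * n - 1" by simp
  have e0: "0 \<le> ?e n" by (intro Bochner_Integration.integral_nonneg) (simp add: input_bound_nonneg b)

  define D where "D = {s \<in> state_space M. \<forall>j\<in>{1..M}. fst s j \<le> n \<and> snd s j \<le> n}"
  define V where "V t s = (\<Sum>j\<in>{1..M}. K * huber n (red_level M (1 - p) t s j)
      + huber n (green_level b s j))" for t s
  let ?L = "slot_law M p \<xi> \<eta>"

  \<comment> \<open>Red and green are balanced within each station, so one long queue anywhere
    suffices and no other station has to be compensated.\<close>
  have station: "K * (\<epsilon>R * min (red_level M (1 - p) t s j) n)
      - (c - r * of_bool (snd s j > 0)) * min (green_level b s j) n
     \<ge> \<epsilon> * n * of_bool (fst s j > n \<or> snd s j > n)" if j: "j \<in> {1..M}" for t s j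
  proof -
    define X where "X = red_level M (1 - p) t s j"
    define W where "W = green_level b s j"
    have XR: "X \<ge> fst s j" using p M by (simp add: X_def red_level_def)
    have KX: "K * (\<epsilon>R * min X n) = \<epsilon>R * min X n + c * ((1 + b) * min X n)"
      using \<epsilon>R by (simp add: K_def field_simps)
    have X0: "0 \<le> min X n" and W0: "0 \<le> min W n"
      using XR b by (auto simp: W_def green_level_def)
    have big: "\<epsilon> * n \<le> \<epsilon>R * min X n" if "fst s j > n"
      using that XR \<epsilon> by (auto simp: \<epsilon>_def min_absorb2 intro!: mult_right_mono)
    show ?thesis
    proof (cases "snd s j = 0")
      case True
      \<comment> \<open>The factor \<open>b\<close> alone would bound \<open>W\<close>, but for
        \<open>b < 1\<close> it would not survive truncation at \<open>n\<close>.\<close>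
      have "min W n \<le> (1 + b) * min X n"
      proof -
        have "b * real (fst s j) \<le> b * X" using XR b(1) by (rule mult_left_mono)
        then have "W \<le> (1 + b) * X"
          using True XR by (simp add: W_def green_level_def algebra_simps)
        moreover have "real n \<le> (1 + b) * real n" using b(1) by (simp add: algebra_simps)
        ultimately show ?thesis by (auto simp: min_def)
      qed
      then have "c * min W n \<le> c * ((1 + b) * min X n)" using c by (rule mult_left_mono)
      moreover have "\<epsilon> * n * of_bool (fst s j > n \<or> snd s j > n) \<le> \<epsilon>R * min X n"
        using big True X0 \<epsilon>R by (cases "fst s j > n") auto
      moreover have service: "c - r * of_bool (snd s j > 0) = c" using True by simp
      ultimately show ?thesis
        unfolding X_def[symmetric] W_def[symmetric] KX service by linarith
    next
      case False
      have "\<epsilon> * n \<le> (r - c) * min W n" if "snd s j > n"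
      proof -
        have "0 \<le> b * real (fst s j)" using b(1) by simp
        then have "W > n" using that unfolding W_def green_level_def by linarith
        then show ?thesis using \<epsilon> by (auto simp: \<epsilon>_def min_absorb2 intro!: mult_right_mono)
      qed
      moreover have "0 \<le> (r - c) * min W n" using \<epsilon>G W0 by simp
      moreover have "0 \<le> \<epsilon>R * min X n" "0 \<le> c * ((1 + b) * min X n)" using \<epsilon>R X0 c b(1) by simp_all
      ultimately show ?thesis
        using big False
        unfolding X_def[symmetric] W_def[symmetric] KX by (auto simp: of_bool_def algebra_simps)
    qed
  qed

  show ?thesis
  \<comment> \<open>Inside \<open>D\<close> no negative drift is available, hence the allowance
    \<open>1 + err\<close>. The bound on \<open>V\<close> uses that the clock adds at most 1 to a
    red level.\<close>
  proof (rule network_stable_Foster[where V = V and D = D and b = "1 + err"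
        and c = "\<Sum>j\<in>{1..M}. K * ((real n + 1)\<^sup>2 / 2) + (real n + b * n)\<^sup>2 / 2"])
    show "M \<ge> 1" by (rule M)
    show "finite D" unfolding D_def by (rule finite_bounded_states)
    show "D \<subseteq> state_space M" by (auto simp: D_def)
    show "V t s \<ge> 0" for t s
      using K unfolding V_def
      by (intro sum_nonneg add_nonneg_nonneg mult_nonneg_nonneg huber_nonneg) auto
    show "V t s \<le> (\<Sum>j\<in>{1..M}. K * ((real n + 1)\<^sup>2 / 2) + (real n + b * n)\<^sup>2 / 2)" if "s \<in> D" for t s
      unfolding V_def
    proof (intro sum_mono add_mono mult_left_mono order_trans[OF huber_le_square]
        divide_right_mono power_mono)
      fix j assume j: "j \<in> {1..M}"
      have "real (slots_to_poll M j t) / M \<le> 1"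
        using slots_to_poll_less[OF M, of j t] by simp
      then have "(1 - p) * (real (slots_to_poll M j t) / M) \<le> 1 * 1"
        using p by (intro mult_mono) auto
      moreover have "real (fst s j) \<le> n" using that j by (simp add: D_def)
      ultimately show "red_level M (1 - p) t s j \<le> real n + 1"
        unfolding red_level_def times_divide_eq_right[symmetric] by simp
      show "green_level b s j \<le> real n + b * n"
        using that j b by (auto simp: green_level_def D_def intro!: add_mono mult_left_mono)
      show "0 \<le> red_level M (1 - p) t s j" "0 \<le> green_level b s j"
        using p b by (simp_all add: red_level_def green_level_def)
    qed (use K in auto)
    fix t :: nat and s :: state assume t: "t \<ge> 1" and s: "s \<in> state_space M"
    define f where "f x = next_state (polled M t) x s" for x
    note rd = red_drift[where M = M and s = s, OF _ t p' of_nat_0_le_iff[of n] b(1) \<xi> \<eta>,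
        folded lam_R_def f_def, folded \<epsilon>R_def]
    note gd = green_drift[where M = M and s = s and t = t,
        OF _ p' of_nat_0_le_iff[of n] b(1) b(2)[unfolded r_def] \<xi> \<eta>,
        folded lam_R_def lam_G_def f_def r_def, folded c_def]
    show "integrable (slot_law M p \<xi> \<eta>) (\<lambda>x. V (Suc t) (next_state (polled M t) x s))"
      unfolding V_def f_def[symmetric]
      by (intro Bochner_Integration.integrable_sum Bochner_Integration.integrable_add
          integrable_mult_right rd gd)
    have "measure_pmf.expectation ?L (\<lambda>x. V (Suc t) (f x)) =
      (\<Sum>j\<in>{1..M}. K * measure_pmf.expectation ?L (\<lambda>x. huber n (red_level M (1 - p) (Suc t) (f x) j))
         + measure_pmf.expectation ?L (\<lambda>x. huber n (green_level b (f x) j)))"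
      unfolding V_def using rd(1) gd(1) by simp
    also have "\<dots> \<le> (\<Sum>j\<in>{1..M}. K * huber n (red_level M (1 - p) t s j) + huber n (green_level b s j)
         + (K + 1) * ?e n - \<epsilon> * n * of_bool (fst s j > n \<or> snd s j > n))"
    proof (rule sum_mono)
      fix j assume j: "j \<in> {1..M}"
      have "K * measure_pmf.expectation ?L (\<lambda>x. huber n (red_level M (1 - p) (Suc t) (f x) j)) \<le>
        K * (huber n (red_level M (1 - p) t s j) - \<epsilon>R * min (red_level M (1 - p) t s j) n + ?e n)"
        using rd(2)[OF j] K by (intro mult_left_mono) auto
      then show "K * measure_pmf.expectation ?L (\<lambda>x. huber n (red_level M (1 - p) (Suc t) (f x) j))
         + measure_pmf.expectation ?L (\<lambda>x. huber n (green_level b (f x) j))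
        \<le> K * huber n (red_level M (1 - p) t s j) + huber n (green_level b s j)
         + (K + 1) * ?e n - \<epsilon> * n * of_bool (fst s j > n \<or> snd s j > n)"
        using gd(2)[OF j] station[OF j, where t = t and s = s]
        unfolding distrib_left right_diff_distrib distrib_right by linarith
    qed
    also have "\<dots> = V t s + err - \<epsilon> * n * (\<Sum>j\<in>{1..M}. of_bool (fst s j > n \<or> snd s j > n))"
      by (simp add: V_def err_def sum.distrib sum_subtractf sum_distrib_left)
    also have "\<dots> \<le> V t s - 1 + (1 + err) * of_bool (s \<in> D)"
    proof (cases "s \<in> D")
      case True
      then show ?thesis using \<epsilon> by (simp add: sum_nonneg)
    next
      case False
      \<comment> \<open>Outside \<open>D\<close> some queue exceeds \<open>n\<close>; its term
        \<open>\<epsilon> * n\<close> beats \<open>err\<close> by at least 1.\<close>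
      then obtain j where j: "j \<in> {1..M}" "fst s j > n \<or> snd s j > n"
        using s by (auto simp: D_def not_le)
      then have "(1 :: real) \<le> of_bool (fst s j > n \<or> snd s j > n)" by simp
      also have "\<dots> \<le> (\<Sum>j\<in>{1..M}. of_bool (fst s j > n \<or> snd s j > n))"
        using j by (intro member_le_sum) auto
      finally have "\<epsilon> * n * 1 \<le> \<epsilon> * n * (\<Sum>j\<in>{1..M}. of_bool (fst s j > n \<or> snd s j > n))"
        using \<epsilon> by (intro mult_left_mono) auto
      then show ?thesis using False err by simp
    qed
    finally show "measure_pmf.expectation (slot_law M p \<xi> \<eta>)
        (\<lambda>x. V (Suc t) (next_state (polled M t) x s)) \<le> V t s - 1 + (1 + err) * of_bool (s \<in> D)"
      by (simp add: f_def)
  qed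
qed

theorem theorem4:
  fixes M :: nat and p lam_R lam_G :: real and \<xi> \<eta> :: "nat pmf"
  assumes "M \<ge> 1"
    and "0 < p" and "p < 1"
    and "integrable (measure_pmf \<xi>) real" and "lam_R = measure_pmf.expectation \<xi> real"
    and "integrable (measure_pmf \<eta>) real" and "lam_G = measure_pmf.expectation \<eta> real"
    and "lam_R < 1 - p"
    and "M = 1 \<Longrightarrow> lam_G < (1 - lam_R / (1 - p)) * p"
    and "M > 1 \<Longrightarrow> lam_G < lam_R / (1 - p) * real (M - 1) * p * (1 - p) ^ (M - 1)
                        + (1 - lam_R / (1 - p)) * real M * p * (1 - p) ^ (M - 1)"
  shows "network_stable M p \<xi> \<eta>"
proof -
  \<comment> \<open>With \<rho> the ratio \<open>lam_R / (1 - p)\<close>, the identity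
    \<open>\<rho> * (M - 1) + (1 - \<rho>) * M = M - \<rho>\<close> puts the case
    \<open>M > 1\<close> in this form; for \<open>M = 1\<close> the power is 1.\<close>
  have "lam_G < (real M - lam_R / (1 - p)) * (p * (1 - p) ^ (M - 1))"
  proof (cases "M = 1")
    case True
    then show ?thesis using assms(9) by simp
  next
    case False
    then have "M > 1" using assms(1) by simp
    have "\<rho> * real (M - 1) * p * z + (1 - \<rho>) * real M * p * z = (real M - \<rho>) * (p * z)" for \<rho> z
      using \<open>M > 1\<close> by (simp add: of_nat_diff algebra_simps)
    with assms(10)[OF \<open>M > 1\<close>] show ?thesis by (simp only:)
  qed
  then show ?thesis
    using assms by (intro network_stable_if_rates) auto
qed

end
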